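(* Let $g=g(n)\ge 0$ be a function with $g(n)=o(n)$ and $g(n)=\omega(1/n)$, let $p=1-g/n$, and let $G\in\mathcal{G}(n,p)$. There is a constant $c$ such that: (1) if $g\ge c\log n$, then almost surely $\mathrm{box}(G)=\Omega(n)$; (2) if $g<c\log n$, then almost surely $\mathrm{box}(G)=\Omega\!\left(\frac{ng}{\log n}\right)$.
   Context: $\mathcal{G}(n,p)$ is the random graph on $n$ labelled vertices in which each possible edge is present independently with probability $p$. "Almost surely" means with probability tending to $1$ as $n\to\infty$. The boxicity $\mathrm{box}(G)$ is the minimum $k$ such that there are interval graphs $I_1,\dots,I_k$ on $V(G)$ with $E(G)=E(I_1)\cap\cdots\cap E(I_k)$. $f=o(h)$ means $f/h\to0$, and $f=\omega(h)$ means $h=o(f)$; $\log$ is the natural logarithm. *)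

theory Defs
  imports "HOL-Probability.Probability" "HOL-Probability.Product_PMF" "HOL-Library.Landau_Symbols"
begin

text \<open>A finite simple graph is given by its vertex set \<open>V\<close> and a set of edges, each edge
  being a two-element subset of \<open>V\<close>.\<close>

definition all_edges :: "'a set \<Rightarrow> 'a set set" where
  "all_edges V = {e. e \<subseteq> V \<and> card e = 2}"

definition interval_graph :: "'a set \<Rightarrow> 'a set set \<Rightarrow> bool" where
  "interval_graph V E \<longleftrightarrow>
     (\<exists>l r :: 'a \<Rightarrow> real. (\<forall>v\<in>V. l v \<le> r v) \<and>
        E = {{u, v} | u v. u \<in> V \<and> v \<in> V \<and> u \<noteq> v \<and> {l u..r u} \<inter> {l v..r v} \<noteq> {}})"

text \<open>The intersection with \<open>all_edges V\<close> only matters for \<open>k = 0\<close>: the empty intersection is the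
  complete graph, so complete graphs have boxicity 0.\<close>

definition box_representation :: "'a set \<Rightarrow> 'a set set \<Rightarrow> nat \<Rightarrow> bool" where
  "box_representation V E k \<longleftrightarrow>
     (\<exists>I :: nat \<Rightarrow> 'a set set. (\<forall>i<k. interval_graph V (I i)) \<and>
        E = all_edges V \<inter> (\<Inter>i<k. I i))"

definition boxicity :: "'a set \<Rightarrow> 'a set set \<Rightarrow> nat" where
  "boxicity V E = (LEAST k. box_representation V E k)"

lemma interval_graph_delete_edge:
  assumes "a \<in> V" "b \<in> V" "a \<noteq> b"
  shows "interval_graph V (all_edges V - {{a, b}})"
proof -
  define l r :: "'a \<Rightarrow> real"
    where "l = (\<lambda>v. if v = b then 1 else 0)" and "r = (\<lambda>v. if v = a then 0 else 1)"
  have iff: "{l u..r u} \<inter> {l v..r v} \<noteq> {} \<longleftrightarrow> {u, v} \<noteq> {a, b}" if "u \<noteq> v" for u v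
    using that assms(3) by (auto simp: l_def r_def doubleton_eq_iff)
  have "all_edges V - {{a, b}} =
      {{u, v} | u v. u \<in> V \<and> v \<in> V \<and> u \<noteq> v \<and> {l u..r u} \<inter> {l v..r v} \<noteq> {}}" (is "_ = ?R")
  proof (intro set_eqI iffI)
    fix e assume e: "e \<in> all_edges V - {{a, b}}"
    then obtain u v where "e = {u, v}" "u \<noteq> v" by (auto simp: all_edges_def card_2_iff)
    with e iff[of u v] show "e \<in> ?R" unfolding all_edges_def by blast
  next
    fix e assume "e \<in> ?R"
    then obtain u v where uv: "e = {u, v}" "u \<in> V" "v \<in> V" "u \<noteq> v"
      "{l u..r u} \<inter> {l v..r v} \<noteq> {}" by blast
    with iff[of u v] show "e \<in> all_edges V - {{a, b}}"
      by (simp add: all_edges_def)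
  qed
  moreover have "\<forall>v\<in>V. l v \<le> r v" using assms(3) by (auto simp: l_def r_def)
  ultimately show ?thesis unfolding interval_graph_def by blast
qed

text \<open>The minimum in the definition of boxicity is taken over a nonempty set.\<close>

lemma box_representation_boxicity:
  assumes "finite V" "E \<subseteq> all_edges V"
  shows "box_representation V E (boxicity V E)"
proof -
  have "finite (all_edges V)"
    by (rule finite_subset[of _ "Pow V"]) (use assms in \<open>auto simp: all_edges_def\<close>)
  then obtain h where h: "bij_betw h {0..<card (all_edges V - E)} (all_edges V - E)"
    using ex_bij_betw_nat_finite[of "all_edges V - E"] by blast
  let ?k = "card (all_edges V - E)"
  have im: "h ` {..<?k} = all_edges V - E"
    using h by (simp add: bij_betw_def lessThan_atLeast0)
  have "interval_graph V (all_edges V - {h i})" if "i < ?k" for i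
  proof -
    have "h i \<in> all_edges V" using im that by blast
    then obtain a b where "h i = {a, b}" "a \<in> V" "b \<in> V" "a \<noteq> b"
      by (auto simp: all_edges_def card_2_iff)
    then show ?thesis using interval_graph_delete_edge by metis
  qed
  moreover have "E = all_edges V \<inter> (\<Inter>i<?k. all_edges V - {h i})"
  proof -
    have "all_edges V \<inter> (\<Inter>i<?k. all_edges V - {h i}) = all_edges V - h ` {..<?k}" by blast
    then show ?thesis using im assms(2) by auto
  qed
  ultimately have "box_representation V E ?k"
    unfolding box_representation_def by (intro exI[of _ "\<lambda>i. all_edges V - {h i}"]) blast
  then show ?thesis unfolding boxicity_def by (rule LeastI)
qed

text \<open>The random edge set of \<open>G(n, p)\<close> on the vertex set \<open>{..<n}\<close>. For \<open>p\<close> outside \<open>[0, 1]\<close>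
  the Bernoulli distribution clamps \<open>p\<close> to that interval.\<close>

definition gnp :: "nat \<Rightarrow> real \<Rightarrow> nat set set pmf" where
  "gnp n p =
     map_pmf (\<lambda>f. {e \<in> all_edges {..<n}. f e})
       (Pi_pmf (all_edges {..<n}) False (\<lambda>_. bernoulli_pmf p))"

end

theory Submission imports Defs
begin

text \<open>Let \<open>H\<close> be the complement of \<open>G\<close>, a sparse random graph with edge probability \<open>q = g / n\<close>.
  A representation of \<open>G\<close> by \<open>k\<close> interval graphs covers the edges of \<open>H\<close> by \<open>k\<close> subgraphs of \<open>H\<close>
  that are complements of interval graphs. Such a subgraph is a staircase: the sets of
  vertices whose interval lies to the right of that of \<open>u\<close> decrease as the right endpoint of \<open>u\<close>
  grows, so the first \<open>i\<close> rows contain a complete bipartite graph. A first moment bound on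
  complete bipartite subgraphs of \<open>H\<close> shows that almost surely no such subgraph has
  more than \<open>40 (g + log n)\<close> edges: if \<open>g\<close> exceeds \<open>n powr (1/10)\<close>, the polylogarithmic terms are
  negligible, and otherwise \<open>H\<close> contains no \<open>K\<^sub>2\<^sub>,\<^sub>3\<close>. Since \<open>H\<close> has at least \<open>n g / 16\<close> edges almost
  surely, the boxicity is at least \<open>n g / (640 (g + log n))\<close>, which yields both claims with \<open>c = 1\<close>.\<close>

subsection \<open>Staircases and bicliques\<close>

text \<open>The pair \<open>A\<close>, \<open>B\<close> spans a complete bipartite subgraph (a
  biclique) of the complement graph. Membership of \<open>{a, b}\<close> in
  \<open>all_edges V\<close> forces \<open>A\<close> and \<open>B\<close> to be disjoint, since
  \<open>{a, a}\<close> is a singleton.\<close>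

definition nonadjacent :: "'a set \<Rightarrow> 'a set set \<Rightarrow> 'a set \<Rightarrow> 'a set \<Rightarrow> bool" where
  "nonadjacent V E A B \<longleftrightarrow>
     A \<subseteq> V \<and> B \<subseteq> V \<and> (\<forall>a\<in>A. \<forall>b\<in>B. {a, b} \<in> all_edges V - E)"

lemma nonadjacent_commute: "nonadjacent V E A B \<longleftrightarrow> nonadjacent V E B A"
proof -
  have "nonadjacent V E B A" if "nonadjacent V E A B" for A B
    unfolding nonadjacent_def
  proof (intro conjI ballI)
    fix b a assume "b \<in> B" "a \<in> A"
    then have "{a, b} \<in> all_edges V - E" using that unfolding nonadjacent_def by blast
    then show "{b, a} \<in> all_edges V - E" by (simp only: insert_commute)
  qed (use that in \<open>simp_all add: nonadjacent_def\<close>)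
  then show ?thesis by blast
qed

text \<open>Take \<open>u\<close> in \<open>U\<close> with the largest right endpoint. Whatever
  starts after \<open>u\<close> ends also starts after every other member of \<open>U\<close> ends,
  so \<open>U\<close> and the row of \<open>u\<close> form a biclique and the row has at most
  \<open>D (card U)\<close> elements. Removing \<open>u\<close> and repeating bounds the row of rank
  \<open>i\<close> in the order of \<open>r\<close> by \<open>D i\<close>.\<close>

lemma sum_card_right_le:
  fixes l r :: "'a \<Rightarrow> real" and D :: "nat \<Rightarrow> real"
  assumes "finite V" "U \<subseteq> V"
    and D: "\<And>A B. \<lbrakk>A \<subseteq> V; B \<subseteq> V; A \<noteq> {}; \<forall>a\<in>A. \<forall>b\<in>B. r a < l b\<rbrakk>
              \<Longrightarrow> real (card B) \<le> D (card A)"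
  shows "(\<Sum>u\<in>U. real (card {v \<in> V. r u < l v})) \<le> (\<Sum>i=1..card U. D i)"
  using assms(2)
proof (induction "card U" arbitrary: U)
  case 0
  then have "U = {}" using assms(1) finite_subset by (metis card_0_eq)
  then show ?case by simp
next
  case (Suc k)
  have fU: "finite U" using Suc.prems assms(1) finite_subset by blast
  have "U \<noteq> {}" using Suc.hyps(2) by auto
  define u where "u = arg_min_on (\<lambda>w. - r w) U"
  have u: "u \<in> U" "\<And>w. w \<in> U \<Longrightarrow> r w \<le> r u"
    using arg_min_if_finite[OF fU \<open>U \<noteq> {}\<close>, of "\<lambda>w. - r w"] unfolding u_def by (auto simp: not_less)
  have "real (card {v \<in> V. r u < l v}) \<le> D (card U)"
    using Suc.prems \<open>U \<noteq> {}\<close> u by (intro D) force+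
  moreover have "(\<Sum>u\<in>U - {u}. real (card {v \<in> V. r u < l v})) \<le> (\<Sum>i=1..card (U - {u}). D i)"
    using Suc.hyps Suc.prems u(1) fU by (intro Suc.hyps(1)) auto
  moreover have "card (U - {u}) = k" using Suc.hyps(2) u(1) fU by simp
  ultimately show ?case
    using Suc.hyps(2)[symmetric] by (simp add: sum.remove[OF fU u(1)])
qed

lemma ex_initial_segment:
  fixes r :: "'a \<Rightarrow> real"
  assumes "finite V" "s \<le> card V"
  shows "\<exists>U\<subseteq>V. card U = s \<and> (\<forall>u\<in>U. \<forall>w\<in>V - U. r u \<le> r w)"
  using assms(2)
proof (induction s)
  case 0
  show ?case by (intro exI[of _ "{}"]) auto
next
  case (Suc s)
  then obtain U where U: "U \<subseteq> V" "card U = s" "\<forall>u\<in>U. \<forall>w\<in>V - U. r u \<le> r w" by auto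
  have fU: "finite U" using U(1) assms(1) finite_subset by blast
  have "V - U \<noteq> {}"
    using Suc.prems U(2) card_mono[OF fU, of V] by auto
  define m where "m = arg_min_on r (V - U)"
  have m: "m \<in> V - U" "\<And>w. w \<in> V - U \<Longrightarrow> r m \<le> r w"
    using arg_min_if_finite[of "V - U" r] \<open>V - U \<noteq> {}\<close> assms(1)
    unfolding m_def by (auto simp: not_less)
  show ?case
    using U m fU by (intro exI[of _ "insert m U"]) auto
qed

text \<open>The pairs form a staircase. Its first \<open>s\<close> rows are bounded one by one; all later rows
  lie in the at most \<open>t\<close> columns met by row \<open>s\<close>, which are bounded one by one as well.\<close>

lemma card_interval_order_le:
  fixes l r :: "'a \<Rightarrow> real" and D :: "nat \<Rightarrow> real"
  assumes "finite V" "1 \<le> s" "D s < real t + 1" "\<And>i. 0 \<le> D i"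
    and D: "\<And>A B. \<lbrakk>A \<subseteq> V; B \<subseteq> V; A \<noteq> {}; \<forall>a\<in>A. \<forall>b\<in>B. r a < l b\<rbrakk>
              \<Longrightarrow> real (card B) \<le> D (card A)"
    and D': "\<And>A B. \<lbrakk>A \<subseteq> V; B \<subseteq> V; B \<noteq> {}; \<forall>a\<in>A. \<forall>b\<in>B. r a < l b\<rbrakk>
              \<Longrightarrow> real (card A) \<le> D (card B)"
  shows "real (card {(u, v) \<in> V \<times> V. r u < l v}) \<le> (\<Sum>i=1..s. D i) + (\<Sum>i=1..t. D i)"
proof -
  have rows: "(\<Sum>u\<in>U. real (card {v \<in> V. r u < l v})) \<le> (\<Sum>i=1..card U. D i)" if "U \<subseteq> V" for U
    by (rule sum_card_right_le) (use assms that in auto)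
  \<comment> \<open>This is \<open>rows\<close> after reflecting the real line: the condition
    \<open>r u < l v\<close> becomes \<open>- l v < - r u\<close>, which exchanges left and right
    endpoints, and rows with columns.\<close>
  have columns: "(\<Sum>v\<in>W. real (card {u \<in> V. r u < l v})) \<le> (\<Sum>i=1..card W. D i)" if "W \<subseteq> V" for W
    using sum_card_right_le[of V W "\<lambda>v. - l v" "\<lambda>u. - r u" D] D' assms(1) that by auto
  have mono: "(\<Sum>i=1..a. D i) \<le> (\<Sum>i=1..b. D i)" if "a \<le> b" for a b
    using that assms(4) by (intro sum_mono2) auto
  have S: "{(u, v) \<in> V \<times> V. r u < l v} = Sigma V (\<lambda>u. {v \<in> V. r u < l v})" by auto
  have card_S: "real (card (Sigma U (\<lambda>u. {v \<in> W. r u < l v})))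
      = (\<Sum>u\<in>U. real (card {v \<in> W. r u < l v}))" if "finite U" "finite W" for U W
    using that by (subst card_SigmaI) auto
  show ?thesis
  proof (cases "s \<le> card V")
    \<comment> \<open>With fewer than \<open>s\<close> vertices there are no later rows.\<close>
    case False
    have "real (card {(u, v) \<in> V \<times> V. r u < l v}) \<le> (\<Sum>i=1..card V. D i)"
      unfolding S using card_S[OF assms(1) assms(1)] rows[of V] by simp
    also have "\<dots> \<le> (\<Sum>i=1..s. D i)" using False by (intro mono) auto
    finally show ?thesis using sum_nonneg[of "{1..t}" D] assms(4) by simp
  next
    case True
    obtain U where U: "U \<subseteq> V" "card U = s" "\<forall>u\<in>U. \<forall>w\<in>V - U. r u \<le> r w"
      using ex_initial_segment[OF assms(1) True] by metis
    have fU: "finite U" using U(1) assms(1) finite_subset by blast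
    have "U \<noteq> {}" using U(2) assms(2) by auto
    define m where "m = arg_min_on (\<lambda>w. - r w) U"
    have m: "m \<in> U" "\<And>w. w \<in> U \<Longrightarrow> r w \<le> r m"
      using arg_min_if_finite[OF fU \<open>U \<noteq> {}\<close>, of "\<lambda>w. - r w"] unfolding m_def by (auto simp: not_less)
    define W where "W = {v \<in> V. r m < l v}"
    have W: "W \<subseteq> V" "finite W" using assms(1) by (auto simp: W_def)
    \<comment> \<open>\<open>W\<close> is the row of the last member \<open>m\<close> of
      \<open>U\<close>, so \<open>U\<close> and \<open>W\<close> form a biclique with
      \<open>card U = s\<close>. The assumption \<open>D s < real t + 1\<close> and integrality then
      give \<open>card W \<le> t\<close>.\<close>
    have "real (card W) \<le> D (card U)"
      using U(1) \<open>U \<noteq> {}\<close> m(2) by (intro D) (force simp: W_def)+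
    then have cW: "card W \<le> t" using assms(3) unfolding U(2) by linarith
    let ?R = "Sigma U (\<lambda>u. {v \<in> V. r u < l v})" and ?C = "Sigma W (\<lambda>v. {u \<in> V. r u < l v})"
    have fin: "finite ?R" "finite ?C" using fU assms(1) W by auto
    \<comment> \<open>If \<open>u\<close> lies outside \<open>U\<close>, then
      \<open>r m \<le> r u < l v\<close>, so \<open>v\<close> is a column in
      \<open>W\<close>.\<close>
    have "{(u, v) \<in> V \<times> V. r u < l v} \<subseteq> ?R \<union> prod.swap ` ?C"
      using U(3) m(1) by (force simp: W_def)
    then have "card {(u, v) \<in> V \<times> V. r u < l v} \<le> card (?R \<union> prod.swap ` ?C)"
      using fin by (intro card_mono) auto
    also have "\<dots> \<le> card ?R + card ?C"
      using card_Un_le[of ?R "prod.swap ` ?C"] card_image_le[OF fin(2), of prod.swap] by linarith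
    finally have "real (card {(u, v) \<in> V \<times> V. r u < l v}) \<le> real (card ?R) + real (card ?C)"
      by linarith
    moreover have "real (card ?R) \<le> (\<Sum>i=1..s. D i)"
      using card_S[OF fU assms(1)] rows[OF U(1)] U(2) by simp
    moreover have "real (card ?C) \<le> (\<Sum>i=1..t. D i)"
      using columns[OF W(1)] mono[OF cW] W assms(1) by (subst card_SigmaI) auto
    ultimately show ?thesis by linarith
  qed
qed

section \<open>From staircases to boxicity\<close>

text \<open>Disjoint intervals are ordered on the line, so every nonedge of \<open>I\<close> comes
  from a pair of the staircase. As \<open>E\<close> is contained in \<open>I\<close>, bicliques of
  the staircase are bicliques in the complement of \<open>E\<close>; by symmetry of
  \<open>nonadjacent\<close> the bound \<open>D\<close> applies to either side.\<close>

lemma card_complement_interval_graph_le: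
  fixes D :: "nat \<Rightarrow> real"
  assumes "finite V" "interval_graph V I" "E \<subseteq> I"
    and "1 \<le> s" "D s < real t + 1" "\<And>i. 0 \<le> D i"
    and D: "\<And>A B. \<lbrakk>A \<noteq> {}; nonadjacent V E A B\<rbrakk> \<Longrightarrow> real (card B) \<le> D (card A)"
  shows "real (card (all_edges V - I)) \<le> (\<Sum>i=1..s. D i) + (\<Sum>i=1..t. D i)"
proof -
  obtain l r :: "'a \<Rightarrow> real" where lr: "\<And>v. v \<in> V \<Longrightarrow> l v \<le> r v"
    and I: "I = {{u, v} | u v. u \<in> V \<and> v \<in> V \<and> u \<noteq> v \<and> {l u..r u} \<inter> {l v..r v} \<noteq> {}}"
    using assms(2) unfolding interval_graph_def by blast
  let ?S = "{(u, v) \<in> V \<times> V. r u < l v}"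
  have nonadj: "nonadjacent V E A B"
    if "A \<subseteq> V" "B \<subseteq> V" "\<forall>a\<in>A. \<forall>b\<in>B. r a < l b" for A B
  proof -
    have "{a, b} \<in> all_edges V - E" if ab: "a \<in> V" "b \<in> V" "r a < l b" for a b
    proof -
      have "{a, b} \<notin> I"
        using ab unfolding I by (auto simp: doubleton_eq_iff)
      moreover have "a \<noteq> b" using ab lr[of a] by auto
      ultimately show ?thesis using ab assms(3) by (auto simp: all_edges_def)
    qed
    with that show ?thesis unfolding nonadjacent_def by blast
  qed
  have "all_edges V - I \<subseteq> (\<lambda>(u, v). {u, v}) ` ?S"
  proof
    fix e assume e: "e \<in> all_edges V - I"
    then obtain u v where uv: "e = {u, v}" "u \<noteq> v" "u \<in> V" "v \<in> V"
      by (auto simp: all_edges_def card_2_iff)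
    then have "{l u..r u} \<inter> {l v..r v} = {}" using e unfolding I by blast
    then have "r u < l v \<or> r v < l u"
      using lr[OF uv(3)] lr[OF uv(4)] by (auto simp: Int_atLeastAtMost max_def min_def split: if_splits)
    then show "e \<in> (\<lambda>(u, v). {u, v}) ` ?S"
      using uv by (force simp: insert_commute)
  qed
  moreover have fin: "finite ?S"
    by (rule finite_subset[of _ "V \<times> V"]) (use assms(1) in auto)
  ultimately have "card (all_edges V - I) \<le> card ?S"
    by (rule surj_card_le[rotated])
  moreover have "real (card ?S) \<le> (\<Sum>i=1..s. D i) + (\<Sum>i=1..t. D i)"
    using assms(1,4,5,6) D nonadj nonadjacent_commute[of V E]
    by (intro card_interval_order_le) blast+
  ultimately show ?thesis by linarith
qed

text \<open>A nonedge of the graph is a nonedge of at least one of the interval graphs in an optimal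
  representation, and each of them contributes at most the staircase bound.\<close>

lemma card_nonedges_le_boxicity:
  fixes D :: "nat \<Rightarrow> real"
  assumes "finite V" "E \<subseteq> all_edges V"
    and "1 \<le> s" "D s < real t + 1" "\<And>i. 0 \<le> D i"
    and D: "\<And>A B. \<lbrakk>A \<noteq> {}; nonadjacent V E A B\<rbrakk> \<Longrightarrow> real (card B) \<le> D (card A)"
  shows "real (card (all_edges V - E)) \<le>
           real (boxicity V E) * ((\<Sum>i=1..s. D i) + (\<Sum>i=1..t. D i))"
proof -
  define k where "k = boxicity V E"
  obtain I where I: "\<forall>i<k. interval_graph V (I i)" "E = all_edges V \<inter> (\<Inter>i<k. I i)"
    using box_representation_boxicity[OF assms(1,2)] unfolding box_representation_def k_def by blast
  have "all_edges V - E = (\<Union>i<k. all_edges V - I i)"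
    unfolding I(2) by blast
  then have "real (card (all_edges V - E)) \<le> real (\<Sum>i<k. card (all_edges V - I i))"
    by (simp only: of_nat_le_iff) (rule card_UN_le, simp)
  also have "\<dots> = (\<Sum>i<k. real (card (all_edges V - I i)))" by simp
  also have "\<dots> \<le> (\<Sum>i<k. (\<Sum>i=1..s. D i) + (\<Sum>i=1..t. D i))"
  proof (rule sum_mono)
    fix i assume "i \<in> {..<k}"
    then have "interval_graph V (I i)" "E \<subseteq> I i" using I by auto
    then show "real (card (all_edges V - I i)) \<le> (\<Sum>i=1..s. D i) + (\<Sum>i=1..t. D i)"
      by (rule card_complement_interval_graph_le[OF assms(1) _ _ assms(3-5) D])
  qed
  finally show ?thesis by (simp add: k_def)
qed

subsection \<open>Nonedges and bicliques in the random graph\<close>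

lemma finite_all_edges: "finite V \<Longrightarrow> finite (all_edges V)"
  by (rule finite_subset[of _ "Pow V"]) (auto simp: all_edges_def)

lemma card_all_edges: "finite V \<Longrightarrow> card (all_edges V) = card V choose 2"
  unfolding all_edges_def by (rule n_subsets)

lemma set_pmf_gnp: "E \<in> set_pmf (gnp n p) \<Longrightarrow> E \<subseteq> all_edges {..<n}"
  by (auto simp: gnp_def)

lemma prob_gnp_nonedges:
  assumes "S \<subseteq> all_edges {..<n}" "0 \<le> q" "q \<le> 1"
  shows "measure_pmf.prob (gnp n (1 - q)) {E. E \<inter> S = {}} = q ^ card S"
proof -
  let ?A = "all_edges {..<n}"
  let ?B = "\<lambda>e. if e \<in> S then {False} else UNIV"
  have fin: "finite ?A" by (simp add: finite_all_edges)
  have "(\<lambda>f. {e \<in> ?A. f e}) -` {E. E \<inter> S = {}} = Pi ?A ?B"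
    using assms(1) by (auto simp: Pi_def split: if_splits)
  then have "measure_pmf.prob (gnp n (1 - q)) {E. E \<inter> S = {}}
      = (\<Prod>e\<in>?A. measure_pmf.prob (bernoulli_pmf (1 - q)) (?B e))"
    by (simp add: gnp_def measure_Pi_pmf_Pi[OF fin])
  also have "\<dots> = (\<Prod>e\<in>?A. if e \<in> S then q else 1)"
    using assms(2,3) by (intro prod.cong) (auto simp: measure_pmf_single)
  also have "\<dots> = (\<Prod>e\<in>?A \<inter> S. q)"
    by (rule prod.inter_restrict[OF fin, symmetric])
  also have "?A \<inter> S = S" using assms(1) by blast
  finally show ?thesis by simp
qed

lemma exp_minus_1_le_half: "exp (-1) \<le> (1 / 2 :: real)"
proof -
  have "exp 1 \<ge> (2 :: real)" using exp_ge_add_one_self[of 1] by simp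
  then show ?thesis by (simp add: exp_minus field_simps)
qed

text \<open>A Chernoff lower tail: Markov's inequality for \<open>exp (- X)\<close>, with
  \<open>X\<close> the number of nonedges. By independence the expectation is a product of factors
  \<open>1 - q + q * exp (-1) \<le> exp (- q / 2)\<close>, hence at most
  \<open>exp (- \<mu> / 2)\<close>.\<close>

lemma prob_gnp_few_nonedges:
  fixes n :: nat and q :: real
  assumes "0 \<le> q" "q \<le> 1"
  defines "\<mu> \<equiv> real (n choose 2) * q"
  shows "measure_pmf.prob (gnp n (1 - q)) {E. real (card (all_edges {..<n} - E)) \<le> \<mu> / 4}
           \<le> exp (- \<mu> / 4)"
proof -
  let ?A = "all_edges {..<n}"
  let ?P = "Pi_pmf ?A False (\<lambda>_. bernoulli_pmf (1 - q))"
  let ?X = "\<lambda>f. real (card (?A - {e \<in> ?A. f e}))"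
  let ?Y = "\<lambda>f. \<Prod>e\<in>?A. if f e then 1 else exp (-1 :: real)"
  have fin: "finite ?A" by (simp add: finite_all_edges)
  have Y: "?Y f = exp (- ?X f)" for f
  proof -
    have "?Y f = (\<Prod>e\<in>?A - {e \<in> ?A. f e}. exp (-1))"
      using fin by (intro prod.mono_neutral_cong_right) auto
    then show ?thesis by (simp add: exp_of_nat_mult[symmetric])
  qed
  have int: "integrable (measure_pmf ?P) ?Y"
    unfolding Y by (rule measure_pmf.integrable_const_bound[where B = 1]) auto
  have "measure_pmf.expectation ?P ?Y
      = (\<Prod>e\<in>?A. measure_pmf.expectation (bernoulli_pmf (1 - q)) (\<lambda>b. if b then 1 else exp (-1)))"
    by (rule expectation_prod_Pi_pmf[OF fin]) (auto intro: integrable_measure_pmf_finite)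
  also have "\<dots> = (1 - q + q * exp (-1)) ^ (n choose 2)"
    using assms(1,2) by (simp add: card_all_edges mult.commute)
  also have "\<dots> \<le> exp (- q / 2) ^ (n choose 2)"
  proof (rule power_mono)
    have "1 - q + q * exp (-1) \<le> 1 + (- q / 2)"
      using mult_left_mono[OF exp_minus_1_le_half assms(1)] by simp
    also have "\<dots> \<le> exp (- q / 2)" by (rule exp_ge_add_one_self)
    finally show "1 - q + q * exp (-1) \<le> exp (- q / 2)" .
  qed (use assms(1,2) in simp)
  also have "\<dots> = exp (- \<mu> / 2)"
    by (simp add: exp_of_nat_mult[symmetric] \<mu>_def)
  finally have expect: "measure_pmf.expectation ?P ?Y \<le> exp (- \<mu> / 2)" .
  have "measure_pmf.prob (gnp n (1 - q)) {E. real (card (?A - E)) \<le> \<mu> / 4}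
      = measure_pmf.prob ?P {f. ?X f \<le> \<mu> / 4}"
    by (simp add: gnp_def vimage_def)
  also have "{f. ?X f \<le> \<mu> / 4} = {f \<in> space (measure_pmf ?P). exp (- \<mu> / 4) \<le> ?Y f}"
    unfolding Y by auto
  also have "measure_pmf.prob ?P \<dots> \<le> measure_pmf.expectation ?P ?Y / exp (- \<mu> / 4)"
    by (rule integral_Markov_inequality_measure[where A = "{}"]) (use int in \<open>auto simp: prod_nonneg\<close>)
  also have "\<dots> \<le> exp (- \<mu> / 2) / exp (- \<mu> / 4)"
    by (intro divide_right_mono expect) simp
  also have "\<dots> = exp (- \<mu> / 4)"
    by (simp add: exp_diff[symmetric])
  finally show ?thesis .
qed

text \<open>Union bound over the choices of \<open>A\<close> and \<open>B\<close>; disjoint parts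
  determine \<open>i * d\<close> distinct edges, all of which must be absent.\<close>

lemma prob_gnp_biclique_le:
  assumes "0 \<le> q" "q \<le> 1"
  shows "measure_pmf.prob (gnp n (1 - q))
             {E. \<exists>A B. card A = i \<and> card B = d \<and> nonadjacent {..<n} E A B}
           \<le> real (n choose i) * real (n choose d) * q ^ (i * d)"
proof -
  let ?Q = "\<lambda>k. {A. A \<subseteq> {..<n} \<and> card A = k}"
  let ?M = "gnp n (1 - q)"
  let ?T = "\<lambda>(A, B). {E. nonadjacent {..<n} E A B}"
  have fin: "finite (?Q k)" for k by (rule finite_subset[of _ "Pow {..<n}"]) auto
  have pair: "measure_pmf.prob ?M (?T (A, B)) \<le> q ^ (i * d)" if "A \<in> ?Q i" "B \<in> ?Q d" for A B
  proof (cases "A \<inter> B = {}")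
    case True
    let ?S = "(\<lambda>(a, b). {a, b}) ` (A \<times> B)"
    have "inj_on (\<lambda>(a, b). {a, b}) (A \<times> B)"
      using True by (auto simp: inj_on_def doubleton_eq_iff)
    then have card: "card ?S = i * d" using that by (simp add: card_image card_cartesian_product)
    have "?S \<subseteq> all_edges {..<n}"
      using that True by (auto simp: all_edges_def card_insert_if)
    then have "measure_pmf.prob ?M {E. E \<inter> ?S = {}} = q ^ (i * d)"
      using prob_gnp_nonedges[OF _ assms] card by metis
    moreover have "measure_pmf.prob ?M (?T (A, B)) \<le> measure_pmf.prob ?M {E. E \<inter> ?S = {}}"
      by (rule measure_pmf.finite_measure_mono) (auto simp: nonadjacent_def)
    ultimately show ?thesis by simp
  next
    \<comment> \<open>A common vertex \<open>a\<close> would make the singleton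
      \<open>{a, a}\<close> an edge, so the event is empty.\<close>
    case False
    then obtain a where "a \<in> A" "a \<in> B" by blast
    moreover have "{a, a} \<notin> all_edges {..<n}" by (simp add: all_edges_def)
    ultimately have "?T (A, B) = {}" unfolding nonadjacent_def by blast
    then show ?thesis using assms(1) by simp
  qed
  have "measure_pmf.prob ?M {E. \<exists>A B. card A = i \<and> card B = d \<and> nonadjacent {..<n} E A B}
      \<le> measure_pmf.prob ?M (\<Union>p\<in>?Q i \<times> ?Q d. ?T p)"
    by (rule measure_pmf.finite_measure_mono) (auto simp: nonadjacent_def)
  also have "\<dots> \<le> (\<Sum>p\<in>?Q i \<times> ?Q d. measure_pmf.prob ?M (?T p))"
    using fin by (intro measure_UNION_le) auto
  also have "\<dots> \<le> (\<Sum>p\<in>?Q i \<times> ?Q d. q ^ (i * d))"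
    using pair by (intro sum_mono) auto
  also have "\<dots> = real (n choose i) * real (n choose d) * q ^ (i * d)"
    by (simp add: card_cartesian_product n_subsets)
  finally show ?thesis .
qed

section \<open>Estimates for binomial coefficients and factorials\<close>

lemma binomial_le_power: "real (n choose k) \<le> real n ^ k"
proof -
  have "(1 :: nat) \<le> fact k" by (rule fact_ge_1)
  then have "(n choose k) * 1 \<le> (n choose k) * fact k" by (rule mult_le_mono2)
  also have "\<dots> \<le> n ^ k" by (rule binomial_fact_pow)
  finally show ?thesis by (metis mult_1_right of_nat_le_iff of_nat_power)
qed

lemma exp_2_le_9: "exp 2 \<le> (9 :: real)"
proof -
  have "exp 2 = exp (1::real) ^ 2" by (simp add: exp_of_nat_mult[symmetric])
  also have "\<dots> \<le> 3 ^ 2" using exp_le by (intro power_mono) auto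
  finally show ?thesis by simp
qed

text \<open>The left side divided by \<open>fact d\<close> is a single term of the exponential
  series at \<open>d\<close>.\<close>

lemma power_le_exp_mult_fact: "real d ^ d \<le> exp (real d) * fact d"
proof -
  have "(\<Sum>k\<in>{d}. real d ^ k /\<^sub>R fact k) \<le> (\<Sum>k. real d ^ k /\<^sub>R fact k)"
    by (rule sum_le_suminf) (use exp_converges[of "real d"] in \<open>auto simp: sums_iff\<close>)
  then have "real d ^ d /\<^sub>R fact d \<le> exp (real d)"
    unfolding exp_def by simp
  then show ?thesis by (simp add: field_simps)
qed

text \<open>The binomial coefficient is at most \<open>(exp 1 * n / d) ^ d\<close>, so the factor
  \<open>exp 2\<close> in the hypothesis leaves \<open>exp (-1)\<close> for each of the
  \<open>d\<close> factors. Both sides are multiplied by \<open>d ^ d\<close> to avoid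
  division.\<close>

lemma binomial_mult_power_le:
  fixes x :: real
  assumes "0 \<le> x" "exp 2 * real n * x \<le> real d"
  shows "real (n choose d) * x ^ d \<le> exp (- real d)"
proof -
  have "(real (n choose d) * x ^ d) * real d ^ d \<le> (real (n choose d) * x ^ d) * (exp (real d) * fact d)"
    by (intro mult_left_mono power_le_exp_mult_fact) (use assms in auto)
  also have "\<dots> = real ((n choose d) * fact d) * x ^ d * exp (real d)" by simp
  also have "\<dots> \<le> real (n ^ d) * x ^ d * exp (real d)"
    using assms(1) by (intro mult_right_mono of_nat_mono binomial_fact_pow) auto
  also have "\<dots> = (exp 2 * real n * x) ^ d * exp (- real d)"
    by (simp add: power_mult_distrib exp_of_nat_mult[symmetric] mult_exp_exp)
  also have "\<dots> \<le> real d ^ d * exp (- real d)"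
    using assms by (intro mult_right_mono power_mono) auto
  finally show ?thesis by (cases "d = 0") (auto simp: mult.commute)
qed

section \<open>Large bicliques in the complement of the random graph\<close>

lemma nonadjacent_subsets:
  assumes "nonadjacent V E A B" "i \<le> card A" "d \<le> card B"
  shows "\<exists>A' B'. card A' = i \<and> card B' = d \<and> nonadjacent V E A' B'"
proof -
  obtain A' B' where "A' \<subseteq> A" "card A' = i" "B' \<subseteq> B" "card B' = d"
    using assms(2,3) obtain_subset_with_card_n by metis
  then show ?thesis
    using assms(1) unfolding nonadjacent_def by (intro exI[of _ A'] exI[of _ B']) blast
qed

text \<open>The first summand makes the expected number of complete bipartite subgraphs of the complement
  with parts of size \<open>i\<close> and \<open>d \<ge> biclique_bound n q i\<close> at most \<open>n ^ i * exp (- d)\<close>; the second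
  makes this summable over \<open>i\<close>.\<close>

definition biclique_bound :: "nat \<Rightarrow> real \<Rightarrow> nat \<Rightarrow> real" where
  "biclique_bound n q i = exp 2 * real n * q ^ i + 3 * real i * ln (real n)"

text \<open>An oversized \<open>B\<close> can be shrunk to exactly \<open>d i\<close> vertices. For
  fixed \<open>i\<close> the first moment is at most \<open>n ^ i * exp (- d i)\<close>, which the
  logarithmic summand of the bound reduces to \<open>n ^ i / n ^ (3 * i) \<le> 1 / n ^ 2\<close>;
  there are \<open>n\<close> values of \<open>i\<close>.\<close>

lemma prob_gnp_large_biclique:
  assumes "1 \<le> n" "0 \<le> q" "q \<le> 1"
  shows "measure_pmf.prob (gnp n (1 - q))
           {E. \<exists>A B. A \<noteq> {} \<and> nonadjacent {..<n} E A B \<and> biclique_bound n q (card A) < real (card B)}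
         \<le> 1 / real n"
proof -
  let ?M = "gnp n (1 - q)"
  define d where "d i = nat \<lceil>biclique_bound n q i\<rceil>" for i
  let ?T = "\<lambda>i. {E. \<exists>A B. card A = i \<and> card B = d i \<and> nonadjacent {..<n} E A B}"
  have T: "measure_pmf.prob ?M (?T i) \<le> 1 / real n ^ 2" if "1 \<le> i" for i
  proof -
    have d: "biclique_bound n q i \<le> real (d i)" unfolding d_def by linarith
    have "0 \<le> 3 * real i * ln (real n)" "0 \<le> exp 2 * real n * q ^ i" using assms by simp_all
    with d have d1: "exp 2 * real n * q ^ i \<le> real (d i)" and d2: "3 * real i * ln (real n) \<le> real (d i)"
      unfolding biclique_bound_def by linarith+
    have "measure_pmf.prob ?M (?T i) \<le> real (n choose i) * (real (n choose d i) * (q ^ i) ^ d i)"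
      using prob_gnp_biclique_le[OF assms(2,3), of n i "d i"] by (simp add: power_mult mult.assoc)
    also have "\<dots> \<le> real n ^ i * exp (- real (d i))"
      using assms(2) d1 by (intro mult_mono binomial_le_power binomial_mult_power_le) auto
    also have "\<dots> \<le> real n ^ i * exp (- (3 * real i * ln (real n)))"
      using d2 by (intro mult_left_mono) auto
    also have "exp (- (3 * real i * ln (real n))) = (1 / real n ^ 3) ^ i"
    proof -
      have "exp (- (3 * real i * ln (real n))) = exp (- (real (3 * i) * ln (real n)))" by simp
      also have "\<dots> = 1 / real n ^ (3 * i)"
        using assms(1) by (subst exp_minus, subst exp_of_nat_mult) (simp add: field_simps)
      finally show ?thesis by (simp add: power_mult power_one_over)
    qed
    also have "real n ^ i * (1 / real n ^ 3) ^ i = (1 / real n ^ 2) ^ i"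
      using assms(1) by (simp add: power_mult_distrib[symmetric] power2_eq_square power3_eq_cube)
    also have "\<dots> \<le> (1 / real n ^ 2) ^ 1"
      using assms(1) that by (intro power_decreasing) auto
    finally show ?thesis by simp
  qed
  have "{E. \<exists>A B. A \<noteq> {} \<and> nonadjacent {..<n} E A B \<and> biclique_bound n q (card A) < real (card B)}
      \<subseteq> (\<Union>i\<in>{1..n}. ?T i)"
  proof
    fix E
    assume "E \<in> {E. \<exists>A B. A \<noteq> {} \<and> nonadjacent {..<n} E A B \<and>
                         biclique_bound n q (card A) < real (card B)}"
    then obtain A B x where AB: "nonadjacent {..<n} E A B" "biclique_bound n q (card A) < real (card B)" "x \<in> A"
      by blast
    have A: "A \<subseteq> {..<n}" using AB(1) by (simp add: nonadjacent_def)
    then have "card A \<le> n" "finite A"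
      using card_mono[of "{..<n}" A] finite_subset[of A] by auto
    then have "card A \<in> {1..n}" using AB(3) by (auto simp: Suc_le_eq card_gt_0_iff)
    moreover have "d (card A) \<le> card B" using AB(2) unfolding d_def by linarith
    ultimately show "E \<in> (\<Union>i\<in>{1..n}. ?T i)"
      using nonadjacent_subsets[OF AB(1), of "card A" "d (card A)"] by blast
  qed
  then have "measure_pmf.prob ?M
        {E. \<exists>A B. A \<noteq> {} \<and> nonadjacent {..<n} E A B \<and> biclique_bound n q (card A) < real (card B)}
      \<le> measure_pmf.prob ?M (\<Union>i\<in>{1..n}. ?T i)"
    by (intro measure_pmf.finite_measure_mono) auto
  also have "\<dots> \<le> (\<Sum>i=1..n. measure_pmf.prob ?M (?T i))"
    by (intro measure_UNION_le) auto
  also have "\<dots> \<le> (\<Sum>i=1..n. 1 / real n ^ 2)"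
    by (intro sum_mono T) auto
  also have "\<dots> = 1 / real n" by (simp add: power2_eq_square)
  finally show ?thesis .
qed

lemma sum_biclique_bound_le:
  assumes "1 \<le> n" "0 \<le> q" "q \<le> 1 / 2"
  shows "(\<Sum>i=1..m. biclique_bound n q i) \<le> 18 * (real n * q) + 3 * real m ^ 2 * ln (real n)"
proof -
  \<comment> \<open>The subtracted term strengthens the claim enough for the induction to close when
    \<open>q \<le> 1 / 2\<close>.\<close>
  have geo: "(\<Sum>i=1..m. q ^ i) \<le> 2 * q - 2 * q * q ^ m" for m
  proof (induction m)
    case (Suc m)
    have "q ^ Suc m * (2 * q) \<le> q ^ Suc m * 1"
      using assms by (intro mult_left_mono) auto
    then show ?case using Suc by (simp add: algebra_simps)
  qed simp
  have q: "(\<Sum>i=1..m. q ^ i) \<le> 2 * q"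
    by (rule order_trans[OF geo]) (use assms(2) in simp)
  have ln: "0 \<le> ln (real n)" using assms(1) by simp
  have "(\<Sum>i=1..m. biclique_bound n q i)
      = exp 2 * real n * (\<Sum>i=1..m. q ^ i) + 3 * (\<Sum>i=1..m. real i) * ln (real n)"
    by (simp add: biclique_bound_def sum.distrib sum_distrib_left sum_distrib_right)
  also have "\<dots> \<le> 9 * real n * (2 * q) + 3 * (real m * real m) * ln (real n)"
  proof (intro add_mono mult_mono)
    show "(\<Sum>i=1..m. real i) \<le> real m * real m"
      using sum_bounded_above[of "{1..m}" real "real m"] by simp
  qed (use exp_2_le_9 q ln assms(2) in \<open>auto intro!: sum_nonneg mult_nonneg_nonneg\<close>)
  finally show ?thesis by (simp add: power2_eq_square)
qed

subsection \<open>The lower bound on the boxicity\<close>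

text \<open>Without K_{2,3} in the complement a staircase is nearly a union of two stars: only a
  single row and a single column can be long.\<close>

lemma card_nonedges_le_sparse:
  assumes "3 \<le> n" "0 \<le> q" "E \<subseteq> all_edges {..<n}"
    and D: "\<And>A B. \<lbrakk>A \<noteq> {}; nonadjacent {..<n} E A B\<rbrakk> \<Longrightarrow> real (card B) \<le> biclique_bound n q (card A)"
    and K23: "\<And>A B. \<lbrakk>card A = 2; card B = 3\<rbrakk> \<Longrightarrow> \<not> nonadjacent {..<n} E A B"
  shows "real (card (all_edges {..<n} - E)) \<le>
           real (boxicity {..<n} E) * (2 * biclique_bound n q 1 + 4)"
proof -
  \<comment> \<open>Two vertices have at most 2 common nonneighbours by \<open>K23\<close>; three or
    more have at most 1, by \<open>K23\<close> with the sides exchanged.\<close>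
  define D where "D i = (if i = 1 then biclique_bound n q 1 else if i = 2 then 2 else 1)" for i :: nat
  have D1: "0 \<le> biclique_bound n q 1" using assms(1,2) by (simp add: biclique_bound_def)
  have "real (card B) \<le> D (card A)" if A: "A \<noteq> {}" and AB: "nonadjacent {..<n} E A B" for A B
  proof -
    have "A \<subseteq> {..<n}" using AB by (simp add: nonadjacent_def)
    then have "card A \<noteq> 0" using A finite_subset[of A "{..<n}"] by auto
    then consider "card A = 1" | "card A = 2" | "3 \<le> card A" by linarith
    then show ?thesis
    proof cases
      case 1
      then show ?thesis using assms(4)[OF A AB] by (simp add: D_def)
    next
      case 2
      then have "\<not> 3 \<le> card B" using nonadjacent_subsets[OF AB, of 2 3] K23 by auto
      then show ?thesis using 2 by (simp add: D_def)
    next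
      case 3
      then have "\<not> 2 \<le> card B"
        using nonadjacent_subsets[OF AB, of 3 2] K23 nonadjacent_commute by metis
      then show ?thesis using 3 by (simp add: D_def)
    qed
  qed
  \<comment> \<open>The staircase is cut with \<open>s = t = 2\<close>.\<close>
  moreover have "0 \<le> D i" "D 2 < real 2 + 1" for i using D1 by (auto simp: D_def)
  ultimately have "real (card (all_edges {..<n} - E)) \<le>
      real (boxicity {..<n} E) * ((\<Sum>i=1..2. D i) + (\<Sum>i=1..2. D i))"
    by (intro card_nonedges_le_boxicity) (use assms(3) in auto)
  also have "(\<Sum>i=1..2. D i) = biclique_bound n q 1 + 2"
    by (simp add: numeral_2_eq_2 D_def)
  finally show ?thesis by simp
qed

lemma card_nonedges_le_dense:
  assumes "3 \<le> n" "0 \<le> q" "q \<le> exp (-1)" "E \<subseteq> all_edges {..<n}"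
    and D: "\<And>A B. \<lbrakk>A \<noteq> {}; nonadjacent {..<n} E A B\<rbrakk> \<Longrightarrow> real (card B) \<le> biclique_bound n q (card A)"
  shows "real (card (all_edges {..<n} - E)) \<le>
           real (boxicity {..<n} E) * (36 * (real n * q) + 1350 * ln (real n) ^ 5)"
proof -
  define L where "L = ln (real n)"
  have "exp 1 \<le> real n" using exp_le assms(1) by simp
  then have L: "1 \<le> L" using assms(1) unfolding L_def by (subst ln_ge_iff) auto
  \<comment> \<open>About \<open>ln n\<close> rows suffice: as \<open>q \<le> exp (-1)\<close>,
    \<open>n * q ^ s \<le> 1\<close>, and the biclique bound at \<open>s\<close> is only
    \<open>9 + 6 * L ^ 2 \<le> 15 * L ^ 2\<close>. Rounding down then gives the least natural
    \<open>t\<close> with \<open>biclique_bound n q s < t + 1\<close>.\<close>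
  define s where "s = nat \<lceil>L\<rceil>"
  define t where "t = nat \<lfloor>biclique_bound n q s\<rfloor>"
  have s: "L \<le> real s" "real s \<le> 2 * L" "1 \<le> s" using L unfolding s_def by linarith+
  have nonneg: "0 \<le> biclique_bound n q i" for i
    using assms(1,2) by (simp add: biclique_bound_def)
  have t: "biclique_bound n q s < real t + 1" "real t \<le> biclique_bound n q s"
    using nonneg[of s] unfolding t_def by linarith+
  have "q ^ s \<le> exp (-1) ^ s" using assms(2,3) by (intro power_mono)
  also have "\<dots> = exp (- real s)" by (simp add: exp_of_nat_mult[symmetric])
  also have "\<dots> \<le> exp (- L)" using s(1) by simp
  also have "\<dots> = 1 / real n" using assms(1) by (simp add: L_def exp_minus field_simps)
  finally have "real n * q ^ s \<le> 1" using assms(1) by (simp add: field_simps)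
  then have "exp 2 * (real n * q ^ s) \<le> 9 * 1"
    using assms(2) by (intro mult_mono exp_2_le_9) auto
  moreover have "real s * L \<le> 2 * L * L" using s(2) L by (intro mult_right_mono) auto
  moreover have "1 * 1 \<le> L * L" using L by (intro mult_mono) auto
  ultimately have "biclique_bound n q s \<le> 15 * L ^ 2"
    by (simp add: biclique_bound_def L_def[symmetric] power2_eq_square mult.assoc)
  then have t15: "real t \<le> 15 * L ^ 2" using t(2) by linarith
  have s15: "real s \<le> 15 * L ^ 2"
  proof -
    have "L * 1 \<le> L * L" using L by (intro mult_left_mono) auto
    then show ?thesis using s(2) by (simp add: power2_eq_square)
  qed
  have q: "q \<le> 1 / 2" using assms(3) exp_minus_1_le_half by linarith
  \<comment> \<open>One estimate serves both \<open>m = s\<close> and \<open>m = t\<close>; the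
    constant is \<open>3 * 15 ^ 2 = 675\<close>.\<close>
  have sum: "(\<Sum>i=1..m. biclique_bound n q i) \<le> 18 * (real n * q) + 675 * L ^ 5"
    if "real m \<le> 15 * L ^ 2" for m
  proof -
    have "(\<Sum>i=1..m. biclique_bound n q i) \<le> 18 * (real n * q) + 3 * real m ^ 2 * L"
      unfolding L_def using assms(1,2) q by (intro sum_biclique_bound_le) auto
    also have "3 * real m ^ 2 * L \<le> 3 * (15 * L ^ 2) ^ 2 * L"
      using that L by (intro mult_mono power_mono) auto
    also have "\<dots> = 675 * L ^ 5" by (simp add: power_mult_distrib eval_nat_numeral)
    finally show ?thesis by simp
  qed
  have "real (card (all_edges {..<n} - E)) \<le> real (boxicity {..<n} E) *
      ((\<Sum>i=1..s. biclique_bound n q i) + (\<Sum>i=1..t. biclique_bound n q i))"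
    by (rule card_nonedges_le_boxicity[OF _ assms(4) s(3) t(1) nonneg D]) auto
  also have "\<dots> \<le> real (boxicity {..<n} E) * (36 * (real n * q) + 1350 * L ^ 5)"
    using sum[OF s15] sum[OF t15] by (intro mult_left_mono) auto
  finally show ?thesis by (simp add: L_def)
qed

text \<open>Outside three exceptional events (few nonedges, an oversized biclique, a K_{2,3} when
  \<open>g\<close> is small) one of the two deterministic bounds applies. The three error terms
  bound the probabilities of these events.\<close>

lemma prob_boxicity_ge:
  fixes g :: real
  assumes "3 \<le> n" "0 \<le> g" "g \<le> exp (-1) * real n"
    and large: "1350 * ln (real n) ^ 5 \<le> 4 * real n powr (1/10)"
  shows "measure_pmf.prob (gnp n (1 - g / real n))
           {E. real n * g / (640 * (g + ln (real n))) \<le> real (boxicity {..<n} E)}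
         \<ge> 1 - (exp (- (real n * g) / 16) + 1 / real n + real n powr (-2/5))"
proof -
  define q where "q = g / real n"
  let ?M = "gnp n (1 - q)"
  let ?N = "\<lambda>E. all_edges {..<n} - E"
  define few where "few = {E. real (card (?N E)) \<le> real (n choose 2) * q / 4}"
  define big where "big = {E. \<exists>A B. A \<noteq> {} \<and> nonadjacent {..<n} E A B \<and>
                                 biclique_bound n q (card A) < real (card B)}"
  \<comment> \<open>Empty for large \<open>g\<close>, so that a single union bound covers both
    regimes.\<close>
  define k23 where "k23 = (if g \<le> real n powr (1/10)
    then {E. \<exists>A B. card A = 2 \<and> card B = 3 \<and> nonadjacent {..<n} E A B} else {})"
  define good where "good = {E. real n * g / (640 * (g + ln (real n))) \<le> real (boxicity {..<n} E)}"
  have g: "g = real n * q" using assms(1) by (simp add: q_def)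
  have "exp (-1) \<le> (1::real)" by simp
  then have q: "0 \<le> q" "q \<le> exp (-1)" "q \<le> 1"
    using assms(1-3) by (auto simp: q_def field_simps intro: order_trans)
  have "exp 1 \<le> real n" using exp_le assms(1) by simp
  then have L: "1 \<le> ln (real n)" using assms(1) by (subst ln_ge_iff) auto

  have mean: "real n * g / 16 \<le> real (n choose 2) * q / 4"
  proof -
    have "even (n * (n - 1))" by auto
    then have "2 * (n choose 2) = n * (n - 1)" by (simp add: choose_two)
    then have "2 * real (n choose 2) = real (n * (n - 1))" by linarith
    also have "\<dots> = real n * (real n - 1)" using assms(1) by (simp add: of_nat_diff)
    finally have "real (n choose 2) * q / 4 = g * (real n - 1) / 8" by (simp add: g)
    moreover have "g * real n \<le> g * (2 * (real n - 1))"
      using assms(1,2) by (intro mult_left_mono) auto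
    ultimately show ?thesis by (simp add: field_simps)
  qed

  have "E \<in> good"
    if "E \<subseteq> all_edges {..<n}" and bad: "E \<notin> few" "E \<notin> big" "E \<notin> k23" for E
  proof -
    have D: "real (card B) \<le> biclique_bound n q (card A)"
      if "A \<noteq> {}" "nonadjacent {..<n} E A B" for A B
    proof -
      have "\<not> biclique_bound n q (card A) < real (card B)"
        using bad(2) that unfolding big_def by blast
      then show ?thesis by simp
    qed
    have "real (card (?N E)) \<le> real (boxicity {..<n} E) * (40 * (g + ln (real n)))"
    proof (cases "g \<le> real n powr (1/10)")
      case True
      then have "real (card (?N E)) \<le> real (boxicity {..<n} E) * (2 * biclique_bound n q 1 + 4)"
        using bad(3) that(1) assms(1) q(1) D
        by (intro card_nonedges_le_sparse) (auto simp: k23_def)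
      also have "\<dots> \<le> real (boxicity {..<n} E) * (40 * (g + ln (real n)))"
      proof (rule mult_left_mono)
        have "exp 2 * g \<le> 9 * g" using assms(2) exp_2_le_9 by (intro mult_right_mono) auto
        then show "2 * biclique_bound n q 1 + 4 \<le> 40 * (g + ln (real n))"
          using L assms(2) by (simp add: biclique_bound_def g mult.assoc)
      qed simp
      finally show ?thesis .
    next
      case False
      have "real (card (?N E)) \<le>
          real (boxicity {..<n} E) * (36 * (real n * q) + 1350 * ln (real n) ^ 5)"
        by (rule card_nonedges_le_dense[OF assms(1) q(1,2) that(1) D])
      also have "\<dots> \<le> real (boxicity {..<n} E) * (40 * (g + ln (real n)))"
      proof (rule mult_left_mono)
        \<comment> \<open>Here \<open>g > n powr (1/10)\<close>, so \<open>large\<close> absorbs the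
          logarithmic term into \<open>4 * g\<close>.\<close>
        show "36 * (real n * q) + 1350 * ln (real n) ^ 5 \<le> 40 * (g + ln (real n))"
          using False large L unfolding g[symmetric] distrib_left by linarith
      qed simp
      finally show ?thesis .
    qed
    \<comment> \<open>The constant 640 is \<open>16 * 40\<close>.\<close>
    then have "real n * g / 16 \<le> real (boxicity {..<n} E) * (40 * (g + ln (real n)))"
      using bad(1) mean unfolding few_def mem_Collect_eq by linarith
    then show ?thesis
      using L assms(2) by (simp add: good_def field_simps)
  qed
  \<comment> \<open>The inclusion is restricted to the support, where \<open>E\<close> consists of
    genuine edges.\<close>
  then have sub: "(UNIV - good) \<inter> set_pmf ?M \<subseteq> few \<union> big \<union> k23"
    using set_pmf_gnp by blast

  have P_few: "measure_pmf.prob ?M few \<le> exp (- (real n * g) / 16)"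
  proof -
    have "exp (- (real (n choose 2) * q) / 4) \<le> exp (- (real n * g) / 16)"
      using mean by simp
    then show ?thesis
      unfolding few_def using prob_gnp_few_nonedges[OF q(1,3), of n] by linarith
  qed
  have P_big: "measure_pmf.prob ?M big \<le> 1 / real n"
    unfolding big_def by (rule prob_gnp_large_biclique) (use q assms(1) in auto)
  have P_k23: "measure_pmf.prob ?M k23 \<le> real n powr (-2/5)"
  proof (cases "g \<le> real n powr (1/10)")
    case True
    have "measure_pmf.prob ?M k23 \<le> real (n choose 2) * real (n choose 3) * q ^ (2 * 3)"
      using True prob_gnp_biclique_le[OF q(1,3), of n 2 3] by (simp add: k23_def)
    also have "\<dots> \<le> real n ^ 2 * real n ^ 3 * q ^ 6"
      using q(1) by (intro mult_mono binomial_le_power) auto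
    \<comment> \<open>The expected number of copies is of order
      \<open>n ^ 5 * q ^ 6 = g ^ 6 / n\<close>, which tends to 0 because the exponent 1/10 of the
      threshold is below 1/6.\<close>
    also have "\<dots> = g ^ 6 / real n"
      using assms(1) by (simp add: q_def field_simps eval_nat_numeral)
    also have "\<dots> \<le> (real n powr (1/10)) ^ 6 / real n"
      using True assms(2) by (intro divide_right_mono power_mono) auto
    also have "\<dots> = real n powr (6/10) / real n powr 1"
      using assms(1) by (simp add: powr_power)
    also have "\<dots> = real n powr (-2/5)"
      by (subst powr_diff[symmetric]) simp
    finally show ?thesis .
  qed (simp add: k23_def)

  have "measure_pmf.prob ?M (UNIV - good) \<le> measure_pmf.prob ?M (few \<union> big \<union> k23)"
    unfolding measure_Int_set_pmf[of ?M "UNIV - good", symmetric]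
    using sub by (intro measure_pmf.finite_measure_mono) auto
  also have "\<dots> \<le> measure_pmf.prob ?M few + measure_pmf.prob ?M big + measure_pmf.prob ?M k23"
    using measure_Un_le[of "few \<union> big" ?M k23] measure_Un_le[of few ?M big] by simp
  finally have "measure_pmf.prob ?M (UNIV - good)
      \<le> exp (- (real n * g) / 16) + 1 / real n + real n powr (-2/5)"
    using P_few P_big P_k23 by linarith
  moreover have "measure_pmf.prob ?M (UNIV - good) = 1 - measure_pmf.prob ?M good"
    using measure_pmf.prob_compl[of good ?M] by simp
  ultimately show ?thesis
    unfolding good_def q_def by linarith
qed

section \<open>Passage to the limit\<close>

text \<open>With \<open>x = a * ln n\<close> this is the decay of \<open>x ^ k / exp x\<close>,
  since \<open>exp x = n powr a\<close>.\<close>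

lemma eventually_ln_power_le_powr:
  fixes a c :: real
  assumes "0 < a" "0 < c"
  shows "\<forall>\<^sub>F n in sequentially. ln (real n) ^ k \<le> c * real n powr a"
proof -
  have "filterlim (\<lambda>n. a * ln (real n)) at_top sequentially"
    by (rule filterlim_tendsto_pos_mult_at_top[OF tendsto_const assms(1)])
       (rule filterlim_compose[OF ln_at_top filterlim_real_sequentially])
  then have "(\<lambda>n. (a * ln (real n)) ^ k / exp (a * ln (real n))) \<longlonglongrightarrow> 0"
    by (rule filterlim_compose[OF tendsto_power_div_exp_0])
  then have "\<forall>\<^sub>F n in sequentially. (a * ln (real n)) ^ k / exp (a * ln (real n)) < c * a ^ k"
    using assms by (intro order_tendstoD(2)) auto
  then show ?thesis
    using eventually_gt_at_top[of 0]
  proof eventually_elim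
    case (elim n)
    then have "a ^ k * ln (real n) ^ k < a ^ k * (c * real n powr a)"
      by (simp add: powr_def power_mult_distrib pos_divide_less_eq mult_ac)
    then show ?case using assms(1) by simp
  qed
qed

lemma boxicity_gnp_lower_bound:
  fixes g :: "nat \<Rightarrow> real"
  assumes "\<And>n. 0 \<le> g n" "g \<in> o(\<lambda>n. real n)" "g \<in> \<omega>(\<lambda>n. 1 / real n)"
  shows "(\<lambda>n. measure_pmf.prob (gnp n (1 - g n / real n))
            {E. real n * g n / (640 * (g n + ln (real n))) \<le> real (boxicity {..<n} E)}) \<longlonglongrightarrow> 1"
proof (rule tendsto_sandwich)
  \<comment> \<open>The hypothesis \<open>g \<in> \<omega>(\<lambda>n. 1 / real n)\<close> says that
    the expected number of nonedges is unbounded, which kills the Chernoff error.\<close>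
  have "filterlim (\<lambda>n. real n * g n) at_top sequentially"
    unfolding filterlim_at_top_gt[where c = 0]
  proof (intro allI impI)
    fix Z :: real assume "0 < Z"
    then have "\<forall>\<^sub>F n in sequentially. Z * norm (1 / real n) \<le> norm (g n)"
      using landau_omega.smallD[OF assms(3)] by simp
    then show "\<forall>\<^sub>F n in sequentially. Z \<le> real n * g n"
      using eventually_gt_at_top[of 0]
      by eventually_elim (use assms(1) in \<open>simp add: field_simps\<close>)
  qed
  then have "filterlim (\<lambda>n. 1 / 16 * (real n * g n)) at_top sequentially"
    by (rule filterlim_tendsto_pos_mult_at_top[OF tendsto_const, rotated]) simp
  then have "filterlim (\<lambda>n. - (real n * g n) / 16) at_bot sequentially"
    by (subst filterlim_uminus_at_bot) simp
  then have "(\<lambda>n. exp (- (real n * g n) / 16)) \<longlonglongrightarrow> 0"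
    by (rule filterlim_compose[OF exp_at_bot])
  moreover have "(\<lambda>n. 1 / real n) \<longlonglongrightarrow> 0" "(\<lambda>n. real n powr (-2/5)) \<longlonglongrightarrow> 0"
    by (rule lim_1_over_n, rule tendsto_neg_powr) (auto intro: filterlim_real_sequentially)
  ultimately have "(\<lambda>n. 1 - (exp (- (real n * g n) / 16) + 1 / real n + real n powr (-2/5)))
      \<longlonglongrightarrow> 1 - (0 + 0 + 0)"
    by (intro tendsto_intros)
  then show "(\<lambda>n. 1 - (exp (- (real n * g n) / 16) + 1 / real n + real n powr (-2/5))) \<longlonglongrightarrow> 1"
    by simp
  \<comment> \<open>The hypothesis \<open>g \<in> o(\<lambda>n. real n)\<close> supplies
    \<open>q \<le> exp (-1)\<close>.\<close>
  have "\<forall>\<^sub>F n in sequentially. norm (g n) \<le> exp (-1) * norm (real n)"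
    using landau_o.smallD[OF assms(2)] by simp
  moreover have "\<forall>\<^sub>F n in sequentially. 1350 * ln (real n) ^ 5 \<le> 4 * real n powr (1/10)"
    using eventually_ln_power_le_powr[of "1/10" "4/1350" 5] by (simp add: mult.commute)
  ultimately show "\<forall>\<^sub>F n in sequentially.
      1 - (exp (- (real n * g n) / 16) + 1 / real n + real n powr (-2/5))
      \<le> measure_pmf.prob (gnp n (1 - g n / real n))
           {E. real n * g n / (640 * (g n + ln (real n))) \<le> real (boxicity {..<n} E)}"
    using eventually_ge_at_top[of 3]
    by eventually_elim (intro prob_boxicity_ge, use assms(1) in auto)
qed auto

lemma prob_tendsto_1_mono:
  fixes M :: "nat \<Rightarrow> 'a pmf"
  assumes "(\<lambda>n. measure_pmf.prob (M n) (A n)) \<longlonglongrightarrow> 1"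
    and "\<forall>\<^sub>F n in sequentially. A n \<subseteq> B n"
  shows "(\<lambda>n. measure_pmf.prob (M n) (B n)) \<longlonglongrightarrow> 1"
proof (rule tendsto_sandwich[OF _ _ assms(1) tendsto_const])
  show "\<forall>\<^sub>F n in sequentially. measure_pmf.prob (M n) (A n) \<le> measure_pmf.prob (M n) (B n)"
    using assms(2) by eventually_elim (auto intro: measure_pmf.finite_measure_mono)
qed auto

text \<open>Here \<open>g + ln n \<le> 2 * g\<close>, so \<open>g\<close> cancels and 640 doubles to
  1280.\<close>

lemma boxicity_gnp_dense:
  fixes g :: "nat \<Rightarrow> real"
  assumes g: "\<And>n. 0 \<le> g n" "g \<in> o(\<lambda>n. real n)" "g \<in> \<omega>(\<lambda>n. 1 / real n)"
    and "\<forall>\<^sub>F n in sequentially. ln (real n) \<le> g n"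
  shows "(\<lambda>n. measure_pmf.prob (gnp n (1 - g n / real n))
           {E. 1 / 1280 * real n \<le> real (boxicity {..<n} E)}) \<longlonglongrightarrow> 1"
proof (rule prob_tendsto_1_mono[OF boxicity_gnp_lower_bound[OF g]])
  have "\<forall>\<^sub>F n in sequentially. 1 / 1280 * real n \<le> real n * g n / (640 * (g n + ln (real n)))"
    using assms(4) eventually_ge_at_top[of 2]
  proof eventually_elim
    case (elim n)
    then have ln: "0 < ln (real n)" by simp
    have "real n * (g n + ln (real n)) \<le> real n * (2 * g n)"
      using elim by (intro mult_left_mono) auto
    moreover have "0 < g n + ln (real n)"
      by (rule add_nonneg_pos[OF g(1) ln])
    ultimately show ?case by (subst pos_le_divide_eq) (simp_all add: algebra_simps)
  qed
  then show "\<forall>\<^sub>F n in sequentially.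
      {E. real n * g n / (640 * (g n + ln (real n))) \<le> real (boxicity {..<n} E)}
      \<subseteq> {E. 1 / 1280 * real n \<le> real (boxicity {..<n} E)}"
    by eventually_elim (blast intro: order_trans)
qed

text \<open>Here \<open>g + ln n \<le> 2 * ln n\<close>, so the denominator is at most
  \<open>1280 * ln n\<close>.\<close>

lemma boxicity_gnp_sparse:
  fixes g :: "nat \<Rightarrow> real"
  assumes g: "\<And>n. 0 \<le> g n" "g \<in> o(\<lambda>n. real n)" "g \<in> \<omega>(\<lambda>n. 1 / real n)"
    and "\<forall>\<^sub>F n in sequentially. g n < ln (real n)"
  shows "(\<lambda>n. measure_pmf.prob (gnp n (1 - g n / real n))
           {E. 1 / 1280 * (real n * g n / ln (real n)) \<le> real (boxicity {..<n} E)}) \<longlonglongrightarrow> 1"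
proof (rule prob_tendsto_1_mono[OF boxicity_gnp_lower_bound[OF g]])
  have "\<forall>\<^sub>F n in sequentially.
      1 / 1280 * (real n * g n / ln (real n)) \<le> real n * g n / (640 * (g n + ln (real n)))"
    using assms(4) eventually_ge_at_top[of 2]
  proof eventually_elim
    case (elim n)
    then have pos: "0 < ln (real n)" "0 \<le> g n" using g(1) by auto
    have "1 / 1280 * (real n * g n / ln (real n)) = real n * g n / (1280 * ln (real n))" by simp
    also have "\<dots> \<le> real n * g n / (640 * (g n + ln (real n)))"
      using pos elim by (intro divide_left_mono mult_nonneg_nonneg mult_pos_pos) auto
    finally show ?case .
  qed
  then show "\<forall>\<^sub>F n in sequentially.
      {E. real n * g n / (640 * (g n + ln (real n))) \<le> real (boxicity {..<n} E)}
      \<subseteq> {E. 1 / 1280 * (real n * g n / ln (real n)) \<le> real (boxicity {..<n} E)}"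
    by eventually_elim (blast intro: order_trans)
qed

theorem theorem6:
  "\<exists>c::real. c > 0 \<and>
     (\<forall>g :: nat \<Rightarrow> real.
        (\<forall>n. g n \<ge> 0) \<longrightarrow> g \<in> o(\<lambda>n. real n) \<longrightarrow> g \<in> \<omega>(\<lambda>n. 1 / real n) \<longrightarrow>
        ((\<forall>\<^sub>F n in sequentially. g n \<ge> c * ln (real n)) \<longrightarrow>
          (\<exists>C>0. (\<lambda>n. measure_pmf.prob (gnp n (1 - g n / real n))
             {E. real (boxicity {..<n} E) \<ge> C * real n}) \<longlonglongrightarrow> 1)) \<and>
        ((\<forall>\<^sub>F n in sequentially. g n < c * ln (real n)) \<longrightarrow>
          (\<exists>C>0. (\<lambda>n. measure_pmf.prob (gnp n (1 - g n / real n))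
             {E. real (boxicity {..<n} E) \<ge> C * (real n * g n / ln (real n))}) \<longlonglongrightarrow> 1)))"
proof (rule exI[of _ "1::real"], intro conjI allI impI)
  fix g :: "nat \<Rightarrow> real"
  assume g: "\<forall>n. g n \<ge> 0" "g \<in> o(\<lambda>n. real n)" "g \<in> \<omega>(\<lambda>n. 1 / real n)"
  show "\<exists>C>0. (\<lambda>n. measure_pmf.prob (gnp n (1 - g n / real n))
      {E. real (boxicity {..<n} E) \<ge> C * real n}) \<longlonglongrightarrow> 1"
    if "\<forall>\<^sub>F n in sequentially. g n \<ge> 1 * ln (real n)"
    using boxicity_gnp_dense[OF spec[OF g(1)] g(2,3)] that
    by (intro exI[of _ "1 / 1280"]) simp
  show "\<exists>C>0. (\<lambda>n. measure_pmf.prob (gnp n (1 - g n / real n))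
      {E. real (boxicity {..<n} E) \<ge> C * (real n * g n / ln (real n))}) \<longlonglongrightarrow> 1"
    if "\<forall>\<^sub>F n in sequentially. g n < 1 * ln (real n)"
    using boxicity_gnp_sparse[OF spec[OF g(1)] g(2,3)] that
    by (intro exI[of _ "1 / 1280"]) simp
qed simp

end
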